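(* Let $n \geq 1$ and $0 \leq m \leq n$ be integers, and let $\mathbf{t} = (t_1, t_2, \ldots, t_m) \in [n]^m$ be an increasing list (i.e. $t_1 < t_2 < \cdots < t_m$). Let $\mathbf{u} = (u_1, u_2, \ldots, u_{n-m})$ be the increasing rearrangement of $[n] \setminus \{t_1, \ldots, t_m\}$, and let $\mathbf{x} = (u_1, u_2 - u_1, u_3 - u_2, \ldots, u_{n-m} - u_{n-m-1})$. Then $|\operatorname{PC}_n(\mathbf{t})| = P_{n-m}(\mathbf{x})$.
   Context: Write $[n] = \{1, 2, \ldots, n\}$. Parking functions: on a one-way street there are $n$ spots numbered $1, \ldots, n$ in order. Given a preference list $\mathbf{a} = (a_1, \ldots, a_n) \in [n]^n$, cars $1, 2, \ldots, n$ enter in this order; car $i$ parks in the first available spot numbered at least $a_i$, if one exists. The list $\mathbf{a}$ is a parking function of length $n$ if all cars can park. Equivalently (a standard fact), the weakly increasing rearrangement $\mathbf{a}^\uparrow$ of $\mathbf{a}$ satisfies $a_i^\uparrow \leq i$ for all $i \in [n]$. The set of parking functions of length $n$ is denoted $\operatorname{PF}_n$. Parking completions: for a fixed increasing list $\mathbf{t} = (t_1, \ldots, t_m) \in [n]^m$ (spots already taken, so the $t_j$ are distinct), a sequence $\mathbf{c} = (c_1, \ldots, c_{n-m}) \in [n]^{n-m}$ is a parking completion for $\mathbf{t}$ if the concatenation $(t_1, \ldots, t_m, c_1, \ldots, c_{n-m})$ is a parking function of length $n$. The set of all parking completions for $\mathbf{t}$ is denoted $\operatorname{PC}_n(\mathbf{t})$.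 For $\mathbf{x} = (x_1, \ldots, x_N)$, define $$P_N(\mathbf{x}) = \sum_{(a_1, \ldots, a_N) \in \operatorname{PF}_N} x_{a_1} x_{a_2} \cdots x_{a_N},$$ where the sum is over (classical) parking functions of length $N$ (with $P_0 = 1$ for the empty vector). *)

theory Defs
  imports Main
begin

definition available_spots :: "nat \<Rightarrow> nat set \<Rightarrow> nat \<Rightarrow> nat set" where
  "available_spots n S a = {s. a \<le> s \<and> s \<le> n \<and> s \<notin> S}"

(* S is the set of spots that are taken when the cars of the list start to enter. *)
fun all_cars_park :: "nat \<Rightarrow> nat set \<Rightarrow> nat list \<Rightarrow> bool" where
  "all_cars_park n S [] = True"
| "all_cars_park n S (a # as) =
     (available_spots n S a \<noteq> {} \<and>
      all_cars_park n (insert (Min (available_spots n S a)) S) as)"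

definition parking_functions :: "nat \<Rightarrow> nat list set" where
  "parking_functions n =
     {as. length as = n \<and> set as \<subseteq> {1..n} \<and> all_cars_park n {} as}"

definition parking_completions :: "nat \<Rightarrow> nat list \<Rightarrow> nat list set" where
  "parking_completions n t =
     {cs. length cs = n - length t \<and> set cs \<subseteq> {1..n} \<and> t @ cs \<in> parking_functions n}"

(* x ! (a - 1) is the entry x_a: spots and vector entries are numbered from 1,
   list positions from 0. Intended for length x = N. *)
definition parking_sum :: "nat \<Rightarrow> 'a::comm_semiring_1 list \<Rightarrow> 'a" where
  "parking_sum N x = (\<Sum>as\<in>parking_functions N. \<Prod>a\<leftarrow>as. x ! (a - 1))"

(* Integer-valued, so that the subtraction is not truncated. *)
definition consecutive_differences :: "nat list \<Rightarrow> int list" where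
  "consecutive_differences u =
     map (\<lambda>i. if i = 0 then int (u ! 0) else int (u ! i) - int (u ! (i - 1))) [0..<length u]"

end

theory Submission
  imports Defs
begin

text \<open>
  Once the spots of \<^term>\<open>t\<close> are taken, a car preferring spot \<open>p\<close> behaves as if its preference were
  the first free spot \<open>u\<^sub>i \<ge> p\<close>. Replacing every preference by the index \<open>i\<close> of that spot turns the
  parking process on the free spots into the classical one on \<open>1, \<dots>, n - m\<close>, so completions are
  exactly the lists whose index list is a parking function. The index \<open>i\<close> has
  \<open>x\<^sub>i = u\<^sub>i - u\<^sub>i\<^sub>-\<^sub>1\<close> preimages (with \<open>u\<^sub>0 = 0\<close>), so each parking function comes from as many
  completions as its monomial evaluates to at \<open>x\<close>.
\<close>

text \<open>Counting the free spots below \<open>p\<close> makes the function total: beyond the last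
  free spot it takes the value \<open>length u + 1\<close>, which no index list that parks
  contains.\<close>

definition free_index :: "nat list \<Rightarrow> nat \<Rightarrow> nat" where
  "free_index u p = Suc (card {j. j < length u \<and> u ! j < p})"

lemma free_index_ge_1: "1 \<le> free_index u p"
  by (simp add: free_index_def)

text \<open>Since \<open>u\<close> increases, its entries below \<open>p\<close> form an initial
  segment, so comparing their number with \<open>i\<close> amounts to inspecting the entry at
  position \<open>i - 1\<close>. This adjunction between preferences and indices drives both the
  relabelling and the count.\<close>

lemma free_index_le_iff:
  assumes u: "sorted_wrt (<) u" and i: "i \<in> {1..length u}"
  shows "free_index u p \<le> i \<longleftrightarrow> p \<le> u ! (i - 1)"
proof -
  let ?J = "{j. j < length u \<and> u ! j < p}"
  have mono: "u ! j \<le> u ! k" if "j \<le> k" "k < length u" for j k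
    using that sorted_wrt_nth_less[OF u] by (metis le_less)
  show ?thesis
  proof (cases "p \<le> u ! (i - 1)")
    case True
    have "j < i - 1" if "j < length u" "u ! j < p" for j
      using mono[of "i - 1" j] that True by (meson leD leI le_trans)
    then have "?J \<subseteq> {..<i - 1}"
      by auto
    from card_mono[OF _ this] have "card ?J \<le> i - 1"
      by simp
    with i have "Suc (card ?J) \<le> i"
      by auto
    with True show ?thesis
      by (simp add: free_index_def)
  next
    case False
    have "u ! j < p" if "j < i" for j
      using mono[of j "i - 1"] that False i by (simp add: less_eq_Suc_le) linarith
    with i have "{..<i} \<subseteq> ?J"
      by auto
    from card_mono[OF _ this] have "i \<le> card ?J"
      by simp
    with False show ?thesis
      by (simp add: free_index_def)
  qed
qed

text \<open>By the adjunction, the fibre over \<open>a\<close> is the interval of spots after the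
  previous free spot, up to and including \<open>u ! (a - 1)\<close>. For \<open>a = 1\<close> there
  is no previous free spot, and the interval starts at 1.\<close>

lemma card_free_index_eq:
  assumes u: "sorted_wrt (<) u" and un: "set u \<subseteq> {1..n}" and a: "a \<in> {1..length u}"
  shows "int (card {p \<in> {1..n}. free_index u p = a}) = consecutive_differences u ! (a - 1)"
proof (cases "a = 1")
  case True
  with a have "u ! 0 \<in> set u"
    by (simp add: Suc_le_eq)
  with un have "u ! 0 \<le> n"
    by auto
  moreover have "free_index u p = a \<longleftrightarrow> p \<le> u ! 0" for p
    using free_index_le_iff[OF u a, of p] free_index_ge_1[of u p]
    unfolding True by auto
  ultimately have "{p \<in> {1..n}. free_index u p = a} = {1..u ! 0}"
    by fastforce
  with a True show ?thesis
    by (simp add: consecutive_differences_def Suc_le_eq)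
next
  case False
  with a have a': "a - 1 \<in> {1..length u}" and lt: "a - 2 < a - 1" "a - 1 < length u"
    by auto
  have le: "u ! (a - 1) \<le> n"
    using nth_mem[OF lt(2)] un by auto
  have "free_index u p = a \<longleftrightarrow> p \<le> u ! (a - 1) \<and> u ! (a - 2) < p" for p
  proof -
    \<comment> \<open>As \<open>a - 1\<close> is again a valid index here, the adjunction applies at
      both \<open>a\<close> and \<open>a - 1\<close>.\<close>
    have "free_index u p = a \<longleftrightarrow> free_index u p \<le> a \<and> \<not> free_index u p \<le> a - 1"
      using a' by auto
    also have "\<dots> \<longleftrightarrow> p \<le> u ! (a - 1) \<and> \<not> p \<le> u ! (a - 1 - 1)"
      unfolding free_index_le_iff[OF u a] free_index_le_iff[OF u a'] ..
    finally show ?thesis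
      by (simp add: numeral_2_eq_2 not_le)
  qed
  with le have "{p \<in> {1..n}. free_index u p = a} = {u ! (a - 2)<..u ! (a - 1)}"
    by fastforce
  moreover have "u ! (a - 2) < u ! (a - 1)"
    using sorted_wrt_nth_less[OF u lt] .
  ultimately show ?thesis
    using a False lt by (simp add: consecutive_differences_def numeral_2_eq_2)
qed

text \<open>A preference beyond \<open>n\<close> leaves no available spot. On the relabelled street
  this excludes the index \<open>length u + 1\<close>.\<close>

lemma all_cars_park_le: "all_cars_park n S as \<Longrightarrow> set as \<subseteq> {..n}"
  by (induction as arbitrary: S) (auto simp: available_spots_def)

text \<open>Each car of \<open>t\<close> finds its preferred spot free, hence parks exactly
  there.\<close>

lemma all_cars_park_append_distinct:
  assumes "distinct t" "set t \<inter> S = {}" "set t \<subseteq> {..n}"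
  shows "all_cars_park n S (t @ cs) \<longleftrightarrow> all_cars_park n (S \<union> set t) cs"
  using assms
proof (induction t arbitrary: S)
  case (Cons a t)
  then have a: "a \<in> available_spots n S a"
    by (simp add: available_spots_def)
  moreover have "finite (available_spots n S a)"
    by (rule finite_subset[of _ "{..n}"]) (auto simp: available_spots_def)
  ultimately have "Min (available_spots n S a) = a"
    by (intro Min_eqI) (auto simp: available_spots_def)
  with a Cons.prems Cons.IH[of "insert a S"] show ?case
    by auto
qed simp

text \<open>The two streets simulate each other: \<open>e\<close> enumerates the spots outside
  \<open>S\<close>, and \<open>f\<close> is its adjoint on preferences. \<open>T\<close> holds the
  indices of the spots taken so far and is left general so that the induction can let it
  grow.\<close>

lemma all_cars_park_relabel:
  assumes bij: "bij_betw e {1..N} ({1..n} - S)"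
    and mono: "strict_mono_on {1..N} e"
    and le_iff: "\<And>i p. i \<in> {1..N} \<Longrightarrow> f p \<le> i \<longleftrightarrow> p \<le> e i"
    and f: "\<And>p. 1 \<le> f p"
    and "set cs \<subseteq> {1..}" "T \<subseteq> {1..N}"
  shows "all_cars_park n (S \<union> e ` T) cs \<longleftrightarrow> all_cars_park N T (map f cs)"
  using assms(5,6)
proof (induction cs arbitrary: T)
  case (Cons p cs)
  let ?A = "available_spots N T (f p)"
  have A: "?A \<subseteq> {1..N}" "finite ?A"
    using f[of p] by (auto simp: available_spots_def intro: finite_subset[of _ "{..N}"])
  have inj: "e i \<in> e ` T \<longleftrightarrow> i \<in> T" if "i \<in> {1..N}" for i
    using bij that Cons.prems inj_on_image_mem_iff[of e "{1..N}" i T]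
    by (simp add: bij_betw_def)
  \<comment> \<open>A spot outside \<open>S\<close> is some \<open>e i\<close>; it lies at or after
    \<open>p\<close> iff \<open>f p \<le> i\<close>, and it is taken iff
    \<open>i \<in> T\<close>.\<close>
  have avail: "available_spots n (S \<union> e ` T) p = e ` ?A"
  proof (intro equalityI subsetI)
    fix s assume s: "s \<in> available_spots n (S \<union> e ` T) p"
    with Cons.prems have "s \<in> {1..n} - S"
      by (auto simp: available_spots_def)
    with bij obtain i where i: "i \<in> {1..N}" "s = e i"
      by (metis bij_betw_imp_surj_on imageE)
    with s le_iff[of i p] inj[of i] show "s \<in> e ` ?A"
      by (auto simp: available_spots_def)
  next
    fix s assume "s \<in> e ` ?A"
    then obtain i where i: "i \<in> ?A" "s = e i"
      by auto
    with A have "i \<in> {1..N}"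
      by auto
    moreover from this bij have "e i \<in> {1..n} - S"
      by (rule bij_betwE[rule_format, rotated])
    ultimately show "s \<in> available_spots n (S \<union> e ` T) p"
      using i le_iff[of i p] inj[of i] by (auto simp: available_spots_def)
  qed
  show ?case
  proof (cases "?A = {}")
    case False
    have M: "Min ?A \<in> ?A"
      using A False by simp
    \<comment> \<open>Monotonicity of \<open>e\<close> matches the first available spots, so the car
      parks in corresponding places and the invariant persists with \<open>Min ?A\<close> added to
      \<open>T\<close>.\<close>
    have "Min (e ` ?A) = e (Min ?A)"
    proof (rule Min_eqI)
      fix s assume "s \<in> e ` ?A"
      then obtain i where i: "i \<in> ?A" "s = e i"
        by auto
      moreover from i A have "Min ?A \<le> i"
        by simp
      ultimately show "e (Min ?A) \<le> s"
        using strict_mono_on_leD[OF mono, of "Min ?A" i] A M by blast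
    qed (use A M in auto)
    moreover have "all_cars_park n (S \<union> e ` insert (Min ?A) T) cs \<longleftrightarrow>
        all_cars_park N (insert (Min ?A) T) (map f cs)"
      using Cons.prems A M by (intro Cons.IH) auto
    ultimately show ?thesis
      using False by (simp add: avail)
  qed (simp add: avail)
qed simp

lemma finite_parking_functions: "finite (parking_functions n)"
  by (rule finite_subset[OF _ finite_lists_length_eq[of "{1..n}" n]])
    (auto simp: parking_functions_def)

text \<open>The entries of a preimage list are chosen independently, so the fibre sizes
  multiply.\<close>

lemma card_map_preimage:
  "card {cs. set cs \<subseteq> A \<and> map f cs = as} = (\<Prod>a\<leftarrow>as. card {c \<in> A. f c = a})"
proof (induction as)
  case Nil
  have "{cs. set cs \<subseteq> A \<and> map f cs = []} = {[]}"
    by auto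
  then show ?case
    by simp
next
  case (Cons a as)
  have "{cs. set cs \<subseteq> A \<and> map f cs = a # as} =
      (\<lambda>(c, cs). c # cs) ` ({c \<in> A. f c = a} \<times> {cs. set cs \<subseteq> A \<and> map f cs = as})"
    by (auto simp: image_iff map_eq_Cons_conv)
  moreover have "inj_on (\<lambda>(c, cs). c # cs) X" for X :: "('a \<times> 'a list) set"
    by (auto simp: inj_on_def)
  ultimately show ?case
    using Cons by (simp add: card_image card_cartesian_product)
qed

lemma card_map_preimage_set:
  assumes "finite A" "finite L"
  shows "card {cs. set cs \<subseteq> A \<and> map f cs \<in> L} = (\<Sum>as\<in>L. \<Prod>a\<leftarrow>as. card {c \<in> A. f c = a})"
proof -
  have "{cs. set cs \<subseteq> A \<and> map f cs \<in> L} = (\<Union>as\<in>L. {cs. set cs \<subseteq> A \<and> map f cs = as})"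
    by auto
  moreover have "finite {cs. set cs \<subseteq> A \<and> map f cs = as}" for as
    by (rule finite_subset[OF _ finite_lists_length_eq[OF assms(1), of "length as"]]) auto
  ultimately show ?thesis
    using assms(2) by (simp add: card_UN_disjoint disjoint_iff card_map_preimage)
qed

lemma parking_completions_eq:
  assumes t: "distinct t" "set t \<subseteq> {1..n}"
    and u: "u = sorted_list_of_set ({1..n} - set t)"
  shows "parking_completions n t =
    {cs. set cs \<subseteq> {1..n} \<and> map (free_index u) cs \<in> parking_functions (length u)}"
proof -
  have su: "sorted_wrt (<) u" and set_u: "set u = {1..n} - set t"
    by (simp_all add: u)
  have len: "length u = n - length t"
    using t by (simp add: u card_Diff_subset distinct_card)
  have tn: "length t \<le> n"
    using card_mono[OF _ t(2)] distinct_card[OF t(1)] by simp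
  \<comment> \<open>The shift reconciles spots numbered from 1 with list positions numbered from
    0.\<close>
  define e where "e i = u ! (i - 1)" for i
  have mono: "strict_mono_on {1..length u} e"
    by (auto simp: strict_mono_on_def e_def intro!: sorted_wrt_nth_less[OF su])
  have "e ` {1..length u} = set u"
  proof (intro equalityI subsetI)
    fix s assume "s \<in> set u"
    then obtain j where "j < length u" "s = u ! j"
      by (auto simp: in_set_conv_nth)
    then show "s \<in> e ` {1..length u}"
      by (intro image_eqI[of _ _ "Suc j"]) (auto simp: e_def)
  qed (auto simp: e_def)
  then have bij: "bij_betw e {1..length u} ({1..n} - set t)"
    using strict_mono_on_imp_inj_on[OF mono] by (simp add: bij_betw_def set_u)
  have park: "all_cars_park n {} (t @ cs) \<longleftrightarrow>
      all_cars_park (length u) {} (map (free_index u) cs)" if "set cs \<subseteq> {1..n}" for cs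
  proof -
    have "all_cars_park n {} (t @ cs) \<longleftrightarrow> all_cars_park n (set t) cs"
      using all_cars_park_append_distinct[OF t(1), of "{}" n cs] t(2)
      by (simp add: subset_iff)
    also have "\<dots> \<longleftrightarrow> all_cars_park (length u) {} (map (free_index u) cs)"
      \<comment> \<open>The simulation starts with \<open>S = set t\<close> occupied and no index
        taken.\<close>
      using all_cars_park_relabel[OF bij mono, of "free_index u" cs "{}"] that
        free_index_le_iff[OF su] free_index_ge_1 by (simp add: e_def subset_iff)
    finally show ?thesis .
  qed
  \<comment> \<open>Parking itself forces the indices into range, so membership in
    \<open>parking_functions\<close> reduces to the length and the parking condition.\<close>
  have "set (map (free_index u) cs) \<subseteq> {1..length u}"
    if "all_cars_park (length u) {} (map (free_index u) cs)" for cs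
    using all_cars_park_le[OF that] free_index_ge_1[of u] by auto
  then have "map (free_index u) cs \<in> parking_functions (length u) \<longleftrightarrow>
      length cs = length u \<and> all_cars_park (length u) {} (map (free_index u) cs)" for cs
    by (auto simp only: parking_functions_def length_map mem_Collect_eq)
  moreover have "t @ cs \<in> parking_functions n \<longleftrightarrow>
      length cs = length u \<and> all_cars_park n {} (t @ cs)" if "set cs \<subseteq> {1..n}" for cs
    using that t(2) tn by (auto simp: parking_functions_def len)
  ultimately show ?thesis
    using park by (auto simp: parking_completions_def len simp del: atLeastAtMost_iff)
qed

theorem corollary2p8:
  fixes n m :: nat and t u :: "nat list" and x :: "int list"
  assumes "n \<ge> 1" and "m \<le> n"
    and "length t = m" and "set t \<subseteq> {1..n}" and "sorted_wrt (<) t"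
    and "u = sorted_list_of_set ({1..n} - set t)"
    and "x = consecutive_differences u"
  shows "int (card (parking_completions n t)) = parking_sum (n - m) x"
proof -
  have t: "distinct t"
    using assms(5) by (simp add: strict_sorted_iff)
  have u: "sorted_wrt (<) u" "set u \<subseteq> {1..n}" and len: "length u = n - m"
    using assms t by (auto simp: card_Diff_subset distinct_card)
  \<comment> \<open>Fibre sizes become the entries of \<open>x\<close>; the range condition holds
    for every parking function of length \<open>length u\<close>.\<close>
  have prod: "int (\<Prod>a\<leftarrow>as. card {p \<in> {1..n}. free_index u p = a}) = (\<Prod>a\<leftarrow>as. x ! (a - 1))"
    if "set as \<subseteq> {1..length u}" for as
    using that card_free_index_eq[OF u] by (induction as) (auto simp: assms(7))
  have "int (card (parking_completions n t)) =
      (\<Sum>as\<in>parking_functions (length u).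
        int (\<Prod>a\<leftarrow>as. card {p \<in> {1..n}. free_index u p = a}))"
    by (simp add: parking_completions_eq[OF t assms(4,6)]
        card_map_preimage_set[OF _ finite_parking_functions])
  also have "\<dots> = parking_sum (length u) x"
    unfolding parking_sum_def by (intro sum.cong prod) (auto simp: parking_functions_def)
  finally show ?thesis
    by (simp add: len)
qed

end
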